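(* Let $\alpha,\beta,y,q$ be indeterminates, let $\tilde\alpha=(1-q)\frac1\alpha-1$ and $\tilde\beta=(1-q)\frac1\beta-1$, and let $Z_N=Z_N(\alpha,\beta,y,q)$ be the PASEP partition function defined in the context. Then for every $N\ge 0$, \[ Z_N=\frac{1}{(1-q)^N}\sum_{n=0}^{N}R_{N,n}(y,q)\,B_n(\tilde\alpha,\tilde\beta,y,q), \] where \[ R_{N,n}(y,q)=\sum_{i=0}^{\lfloor (N-n)/2\rfloor}(-y)^i q^{\binom{i+1}{2}}\begin{bmatrix} n+i\\ i\end{bmatrix}_q\sum_{j=0}^{N-n-2i}y^j\left(\binom{N}{j}\binom{N}{n+2i+j}-\binom{N}{j-1}\binom{N}{n+2i+j+1}\right) \] and \[ B_n(\tilde\alpha,\tilde\beta,y,q)=\sum_{k=0}^{n}\begin{bmatrix} n\\ k\end{bmatrix}_q\tilde\alpha^k(y\tilde\beta)^{n-k}. \]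
   Context: Let $\mathcal A$ be the associative algebra over $\mathbb Z[y,q]$ generated by two elements $D,E$ subject to the relation $DE-qED=D+E$. Every element of $\mathcal A$ is uniquely a finite $\mathbb Z[y,q]$-linear combination of the words $E^iD^j$ ($i,j\ge0$); write $(yD+E)^N=\sum_{i,j\ge0}c^{(N)}_{i,j}E^iD^j$ with $c^{(N)}_{i,j}\in\mathbb Z[y,q]$. The PASEP partition function is $Z_N(\alpha,\beta,y,q)=\sum_{i,j}c^{(N)}_{i,j}\alpha^{-i}\beta^{-j}$ (equivalently $Z_N=\langle W|(yD+E)^N|V\rangle$ for any operators $D,E$, vector $\langle W|$ and form $|V\rangle$ with $DE-qED=D+E$, $\langle W|\alpha E=\langle W|$, $\beta D|V\rangle=|V\rangle$, $\langle W|V\rangle=1$). $\begin{bmatrix} n\\ k\end{bmatrix}_q$ denotes the Gaussian $q$-binomial coefficient; ordinary binomial coefficients with negative lower index or lower index exceeding the upper one are $0$. *)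

theory Defs
  imports
    "HOL-Library.Poly_Mapping"
    "HOL-Computational_Algebra.Polynomial"
    "HOL-Computational_Algebra.Fraction_Field"
begin

section \<open>The free algebra on \<open>D\<close>, \<open>E\<close> over \<open>\<int>[y,q]\<close>\<close>

text \<open>\<open>\<int>[y,q]\<close> is represented as \<open>\<int>[q][y]\<close>: the outer variable is \<open>y\<close>, the inner one is \<open>q\<close>.\<close>

type_synonym zyq = "int poly poly"

definition zyq_y :: zyq where
  "zyq_y = [:0, 1:]"

definition zyq_q :: zyq where
  "zyq_q = [:[:0, 1:]:]"

datatype letter = LD | LE

text \<open>Words form a monoid under concatenation, written additively so that
  \<open>word \<Rightarrow>\<^sub>0 zyq\<close> with the convolution product of \<open>Poly_Mapping\<close> is the monoid algebra,
  i.e. the free associative unital algebra on two generators.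
  (A separate type is used since lists carry no such monoid instance.)\<close>

datatype word = Word (letters: "letter list")

instantiation word :: monoid_add
begin

definition zero_word :: word where
  "0 = Word []"

definition plus_word :: "word \<Rightarrow> word \<Rightarrow> word" where
  "u + v = Word (letters u @ letters v)"

instance
  by standard (simp_all add: zero_word_def plus_word_def)

end

type_synonym free_alg = "word \<Rightarrow>\<^sub>0 zyq"

definition free_scalar :: "zyq \<Rightarrow> free_alg" where
  "free_scalar c = Poly_Mapping.single 0 c"

definition free_D :: free_alg where
  "free_D = Poly_Mapping.single (Word [LD]) 1"

definition free_E :: free_alg where
  "free_E = Poly_Mapping.single (Word [LE]) 1"

section \<open>The algebra \<open>\<A>\<close>\<close>

text \<open>The two-sided ideal generated by \<open>D E - q E D - (D + E)\<close>.\<close>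

inductive_set pasep_ideal :: "free_alg set" where
  rel: "free_D * free_E - free_scalar zyq_q * free_E * free_D - (free_D + free_E) \<in> pasep_ideal"
| zero: "0 \<in> pasep_ideal"
| add: "a \<in> pasep_ideal \<Longrightarrow> b \<in> pasep_ideal \<Longrightarrow> a + b \<in> pasep_ideal"
| mult_left: "a \<in> pasep_ideal \<Longrightarrow> x * a \<in> pasep_ideal"
| mult_right: "a \<in> pasep_ideal \<Longrightarrow> a * x \<in> pasep_ideal"

lemma pasep_ideal_uminus: "a \<in> pasep_ideal \<Longrightarrow> - a \<in> pasep_ideal"
  using pasep_ideal.mult_left[of a "-1"] by simp

lemma pasep_ideal_diff: "a \<in> pasep_ideal \<Longrightarrow> b \<in> pasep_ideal \<Longrightarrow> a - b \<in> pasep_ideal"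
  using pasep_ideal.add[of a "- b"] pasep_ideal_uminus by simp

definition pasep_cong :: "free_alg \<Rightarrow> free_alg \<Rightarrow> bool" where
  "pasep_cong a b \<longleftrightarrow> a - b \<in> pasep_ideal"

lemma pasep_cong_equivp: "equivp pasep_cong"
proof (rule equivpI)
  show "reflp pasep_cong"
    by (simp add: reflp_def pasep_cong_def pasep_ideal.zero)
  show "symp pasep_cong"
    using pasep_ideal_uminus by (fastforce simp: symp_def pasep_cong_def)
  show "transp pasep_cong"
    using pasep_ideal.add by (fastforce simp: transp_def pasep_cong_def)
qed

quotient_type pasep_alg = free_alg / pasep_cong
  by (rule pasep_cong_equivp)

instantiation pasep_alg :: ring
begin

lift_definition zero_pasep_alg :: pasep_alg is 0 .

lift_definition plus_pasep_alg :: "pasep_alg \<Rightarrow> pasep_alg \<Rightarrow> pasep_alg" is "(+)"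
proof -
  fix a b c d :: free_alg
  assume "pasep_cong a b" "pasep_cong c d"
  then show "pasep_cong (a + c) (b + d)"
    using pasep_ideal.add[of "a - b" "c - d"] by (simp add: pasep_cong_def algebra_simps)
qed

lift_definition uminus_pasep_alg :: "pasep_alg \<Rightarrow> pasep_alg" is uminus
  using pasep_ideal_uminus by (fastforce simp: pasep_cong_def)

lift_definition minus_pasep_alg :: "pasep_alg \<Rightarrow> pasep_alg \<Rightarrow> pasep_alg" is "(-)"
proof -
  fix a b c d :: free_alg
  assume "pasep_cong a b" "pasep_cong c d"
  then show "pasep_cong (a - c) (b - d)"
    using pasep_ideal_diff[of "a - b" "c - d"] by (simp add: pasep_cong_def algebra_simps)
qed

lift_definition times_pasep_alg :: "pasep_alg \<Rightarrow> pasep_alg \<Rightarrow> pasep_alg" is "(*)"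
proof -
  fix a b c d :: free_alg
  assume "pasep_cong a b" "pasep_cong c d"
  then have "(a - b) * c + b * (c - d) \<in> pasep_ideal"
    unfolding pasep_cong_def
    by (intro pasep_ideal.add pasep_ideal.mult_left pasep_ideal.mult_right)
  then show "pasep_cong (a * c) (b * d)"
    by (simp add: pasep_cong_def algebra_simps)
qed

instance
  by standard (transfer; simp add: pasep_cong_def pasep_ideal.zero algebra_simps)+

end

instantiation pasep_alg :: monoid_mult
begin

lift_definition one_pasep_alg :: pasep_alg is 1 .

instance
  by standard (transfer; simp add: pasep_cong_def pasep_ideal.zero)+

end

lift_definition alg_scalar :: "zyq \<Rightarrow> pasep_alg" is free_scalar .

lift_definition alg_D :: pasep_alg is free_D .

lift_definition alg_E :: pasep_alg is free_E .

lemma alg_relation: "alg_D * alg_E - alg_scalar zyq_q * alg_E * alg_D = alg_D + alg_E"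
  by transfer (simp add: pasep_cong_def pasep_ideal.rel)

text \<open>The finitely supported family of coefficients \<open>c\<^sub>i\<^sub>j\<close> with
  \<open>x = \<Sum>\<^bsub>i,j\<^esub> c\<^sub>i\<^sub>j E\<^sup>i D\<^sup>j\<close>.  It exists and is unique because the words \<open>E\<^sup>i D\<^sup>j\<close> are a
  \<open>\<int>[y,q]\<close>-basis of the algebra.\<close>

definition normal_coeffs :: "pasep_alg \<Rightarrow> ((nat \<times> nat) \<Rightarrow>\<^sub>0 zyq)" where
  "normal_coeffs x =
    (THE c. x = (\<Sum>(i, j)\<in>Poly_Mapping.keys c.
       alg_scalar (Poly_Mapping.lookup c (i, j)) * alg_E ^ i * alg_D ^ j))"

definition pasep_coeffs :: "nat \<Rightarrow> ((nat \<times> nat) \<Rightarrow>\<^sub>0 zyq)" where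
  "pasep_coeffs N = normal_coeffs ((alg_scalar zyq_y * alg_D + alg_E) ^ N)"

section \<open>The field \<open>\<rat>(\<alpha>,\<beta>,y,q)\<close> and the partition function\<close>

text \<open>The fraction field of \<open>\<int>[q][y][\<alpha>][\<beta>]\<close>.\<close>

type_synonym ratfun = "zyq poly poly fract"

definition of_zyq :: "zyq \<Rightarrow> ratfun" where
  "of_zyq c = Fract [:[:c:]:] 1"

definition ind_alpha :: ratfun where
  "ind_alpha = Fract [:[:0, 1:]:] 1"

definition ind_beta :: ratfun where
  "ind_beta = Fract [:0, 1:] 1"

definition ind_y :: ratfun where
  "ind_y = of_zyq zyq_y"

definition ind_q :: ratfun where
  "ind_q = of_zyq zyq_q"

definition pasep_Z :: "nat \<Rightarrow> ratfun" where
  "pasep_Z N = (\<Sum>(i, j)\<in>Poly_Mapping.keys (pasep_coeffs N).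
     of_zyq (Poly_Mapping.lookup (pasep_coeffs N) (i, j)) *
       inverse ind_alpha ^ i * inverse ind_beta ^ j)"

definition alpha_tilde :: ratfun where
  "alpha_tilde = (1 - ind_q) * (1 / ind_alpha) - 1"

definition beta_tilde :: ratfun where
  "beta_tilde = (1 - ind_q) * (1 / ind_beta) - 1"

section \<open>\<open>q\<close>-binomials and the polynomials \<open>R\<close> and \<open>B\<close>\<close>

definition q_int :: "'a::field \<Rightarrow> nat \<Rightarrow> 'a" where
  "q_int q n = (\<Sum>i<n. q ^ i)"

definition q_fact :: "'a::field \<Rightarrow> nat \<Rightarrow> 'a" where
  "q_fact q n = (\<Prod>i=1..n. q_int q i)"

text \<open>Meaningful only if no \<open>q_int q m\<close> with \<open>1 \<le> m \<le> n\<close> vanishes, as is the case for the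
  indeterminate \<open>ind_q\<close>.\<close>

definition q_binom :: "'a::field \<Rightarrow> nat \<Rightarrow> nat \<Rightarrow> 'a" where
  "q_binom q n k = (if k \<le> n then q_fact q n / (q_fact q k * q_fact q (n - k)) else 0)"

text \<open>Ordinary binomial coefficient, zero for negative lower index.\<close>

definition binom :: "nat \<Rightarrow> int \<Rightarrow> nat" where
  "binom n k = (if k < 0 then 0 else n choose nat k)"

definition pasep_R :: "nat \<Rightarrow> nat \<Rightarrow> 'a::field \<Rightarrow> 'a \<Rightarrow> 'a" where
  "pasep_R N n y q =
    (\<Sum>i=0..(N - n) div 2. (- y) ^ i * q ^ ((i + 1) choose 2) * q_binom q (n + i) i *
      (\<Sum>j=0..N - n - 2 * i. y ^ j *
        (of_nat (binom N (int j)) * of_nat (binom N (int (n + 2 * i + j)))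
         - of_nat (binom N (int j - 1)) * of_nat (binom N (int (n + 2 * i + j + 1))))))"

definition pasep_B :: "nat \<Rightarrow> 'a::field \<Rightarrow> 'a \<Rightarrow> 'a \<Rightarrow> 'a \<Rightarrow> 'a" where
  "pasep_B n a b y q = (\<Sum>k=0..n. q_binom q n k * a ^ k * (y * b) ^ (n - k))"

end

theory Submission
  imports
    Defs
    "HOL-Computational_Algebra.Polynomial_Factorial"
begin

text \<open>Put \<open>d = (1 - q) D - 1\<close> and \<open>e = (1 - q) E - 1\<close>. Then \<open>d e - q e d = 1 - q\<close>,
  \<open>(1 - q)(y D + E) = y d + e + 1 + y\<close>, and \<open>W\<close>, \<open>V\<close> are eigenvectors of \<open>e\<close>, \<open>d\<close> with
  eigenvalues \<open>\<alpha>~\<close>, \<open>\<beta>~\<close>. The elements \<open>H\<^sub>n = \<Sum>\<^sub>k [n, k]\<^sub>q e\<^sup>k (y d)\<^bsup>n-k\<^esup>\<close>, whose values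
  \<open>\<langle>W|H\<^sub>n|V\<rangle>\<close> are the \<open>B\<^sub>n\<close>, satisfy the \<open>q\<close>-Hermite recurrence
  \<open>H\<^sub>n (y d + e) = H\<^bsub>n+1\<^esub> + y (1 - q\<^sup>n) H\<^bsub>n-1\<^esub>\<close>. So the coefficients of \<open>H\<^sub>n\<close> in
  \<open>(y d + e + 1 + y)\<^sup>N\<close> obey
  \<open>R\<^bsub>N+1,n\<^esub> = (1 + y) R\<^bsub>N,n\<^esub> + R\<^bsub>N,n-1\<^esub> + y (1 - q\<^bsup>n+1\<^esup>) R\<^bsub>N,n+1\<^esub>\<close>, and the explicit
  \<open>R\<^bsub>N,n\<^esub>\<close> is checked to satisfy this recurrence by means of the \<open>q\<close>-Pascal rule.

  The functional \<open>\<langle>W|\<cdot>|V\<rangle>\<close> is realised by operators on sequences. As it maps \<open>E\<^sup>i D\<^sup>j\<close> to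
  \<open>\<alpha>\<^sup>-\<^sup>i \<beta>\<^sup>-\<^sup>j\<close> and these monomials are linearly independent over \<open>\<int>[y,q]\<close>, it also yields the
  uniqueness of normal forms.\<close>

section \<open>Gaussian binomial coefficients\<close>

lemma q_int_mult: "(1 - q) * q_int q n = 1 - q ^ n" for q :: "'a::field"
  unfolding q_int_def by (rule one_diff_power_eq [symmetric])

lemma q_int_add: "q_int q (m + n) = q_int q m + q ^ m * q_int q n" for q :: "'a::field"
  by (induction n) (simp_all add: q_int_def power_add algebra_simps)

lemma q_fact_0: "q_fact q 0 = (1::'a::field)"
  by (simp add: q_fact_def)

lemma q_fact_Suc: "q_fact q (Suc n) = q_fact q n * q_int q (Suc n)"
  by (simp add: q_fact_def)

lemma q_binom_0: "(\<And>n. q_int q (Suc n) \<noteq> (0::'a::field)) \<Longrightarrow> q_binom q n 0 = 1"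
proof -
  assume nz: "\<And>n. q_int q (Suc n) \<noteq> 0"
  have "q_fact q n \<noteq> 0" by (induction n) (simp_all add: q_fact_0 q_fact_Suc nz)
  then show ?thesis by (simp add: q_binom_def q_fact_0)
qed

lemma q_binom_gt: "n < k \<Longrightarrow> q_binom q n k = (0::'a::field)"
  by (simp add: q_binom_def)

context
  fixes q :: "'a::field"
  assumes q_int_nonzero: "\<And>n. q_int q (Suc n) \<noteq> 0"
begin

lemma q_fact_nonzero: "q_fact q n \<noteq> 0"
  by (induction n) (simp_all add: q_fact_0 q_fact_Suc q_int_nonzero)

lemma q_binom_self: "q_binom q n n = 1"
  by (simp add: q_binom_def q_fact_0 q_fact_nonzero)

text \<open>The q-analogue of \<open>(n + 1 - k) C(n + 1, k) = (n + 1) C(n, k)\<close>. At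
  \<open>k = Suc n\<close> the factor \<open>1 - q ^ 0\<close> kills the left side.\<close>

lemma q_binom_absorb_comp:
  "q_binom q (Suc n) k * (1 - q ^ (Suc n - k)) = (1 - q ^ Suc n) * q_binom q n k"
proof (cases "k \<le> n")
  case True
  then show ?thesis
    unfolding q_int_mult[symmetric] using q_int_nonzero[of "n - k"] q_fact_nonzero
    by (simp add: q_binom_def q_fact_Suc Suc_diff_le)
next
  case False
  then show ?thesis by (simp add: q_binom_def)
qed

lemma q_binom_Suc_Suc:
  "q_binom q (Suc n) (Suc k) = q_binom q n (Suc k) + q ^ (n - k) * q_binom q n k"
proof (cases "k < n")
  case True
  then obtain m where n: "n = Suc (k + m)" using less_iff_Suc_add by auto
  \<comment> \<open>Splitting \<open>[n + 1]\<close> as \<open>[n - k] + q^(n-k) [k + 1]\<close>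
    produces the two terms of the rule.\<close>
  have int: "q_int q (Suc (Suc (k + m))) = q_int q (Suc m) + q ^ Suc m * q_int q (Suc k)"
    using q_int_add[of q "Suc m" "Suc k"] by (simp add: add.commute)
  show ?thesis
    using q_int_nonzero q_fact_nonzero
    by (simp add: q_binom_def q_fact_Suc n int divide_simps) (simp add: algebra_simps)
next
  case False
  then show ?thesis
    by (cases "k = n") (simp_all add: q_binom_self q_binom_gt)
qed

end

section \<open>The coefficients \<open>R\<^bsub>N,n\<^esub>\<close>\<close>

text \<open>The coefficient of \<open>x\<^sup>m\<close> in \<open>(1 + x)\<^sup>N (1 + y/x)\<^sup>N = (1 + y + x + y/x)\<^sup>N\<close>,
  whence its recurrence in \<open>N\<close>.\<close>

definition shifted_vandermonde :: "'a::field \<Rightarrow> nat \<Rightarrow> nat \<Rightarrow> 'a" where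
  "shifted_vandermonde y N m = (\<Sum>j\<le>N. y ^ j * of_nat (N choose j) * of_nat (N choose (m + j)))"

lemma shifted_vandermonde_extend:
  "N \<le> K \<Longrightarrow> (\<Sum>j\<le>K. y ^ j * of_nat (N choose j) * of_nat (N choose (m + j))) = shifted_vandermonde y N m"
  unfolding shifted_vandermonde_def
  by (rule sum.mono_neutral_right) (auto simp: binomial_eq_0)

lemma shifted_vandermonde_gt: "N < m \<Longrightarrow> shifted_vandermonde y N m = 0"
  by (simp add: shifted_vandermonde_def binomial_eq_0)

lemma shifted_vandermonde_Suc_Suc:
  "shifted_vandermonde y (Suc N) (Suc m) =
    (1 + y) * shifted_vandermonde y N (Suc m) + shifted_vandermonde y N m
      + y * shifted_vandermonde y N (Suc (Suc m))"
proof -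
  let ?t = "\<lambda>m j. y ^ j * of_nat (N choose j) * of_nat (N choose (m + j))"
  \<comment> \<open>Pascal's rule on both binomials gives four products; at index 0 only two, as
    \<open>N choose 0\<close> has no lower neighbour.\<close>
  have "shifted_vandermonde y (Suc N) (Suc m) =
    (?t (Suc m) 0 + ?t m 0) + (\<Sum>j\<le>N. ?t (Suc m) (Suc j) + ?t m (Suc j)
      + y * ?t (Suc m) j + y * ?t (Suc (Suc m)) j)"
    unfolding shifted_vandermonde_def sum.atMost_Suc_shift
    by (simp add: algebra_simps)
  also have "\<dots> = (\<Sum>j\<le>Suc N. ?t (Suc m) j) + (\<Sum>j\<le>Suc N. ?t m j)
      + y * (\<Sum>j\<le>N. ?t (Suc m) j) + y * (\<Sum>j\<le>N. ?t (Suc (Suc m)) j)"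
    unfolding sum.atMost_Suc_shift by (simp add: sum.distrib sum_distrib_left del: sum.atMost_Suc)
  also have "\<dots> = shifted_vandermonde y N (Suc m) + shifted_vandermonde y N m
      + y * shifted_vandermonde y N (Suc m) + y * shifted_vandermonde y N (Suc (Suc m))"
    by (simp only: shifted_vandermonde_extend[of N "Suc N"] shifted_vandermonde_extend[of N N] le_SucI order_refl)
  finally show ?thesis by (simp add: algebra_simps)
qed

text \<open>The generating function is invariant under \<open>x -> y/x\<close>, so the coefficient
  of \<open>x^-1\<close> is \<open>y\<close> times that of \<open>x\<close>; hence the factor
  2.\<close>

lemma shifted_vandermonde_Suc_0:
  "shifted_vandermonde y (Suc N) 0 =
    (1 + y) * shifted_vandermonde y N 0 + 2 * y * shifted_vandermonde y N 1"
proof -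
  let ?t = "\<lambda>m j. y ^ j * of_nat (N choose j) * of_nat (N choose (m + j))"
  have "shifted_vandermonde y (Suc N) 0 =
    ?t 0 0 + (\<Sum>j\<le>N. ?t 0 (Suc j) + y * ?t 0 j + 2 * y * ?t 1 j)"
    unfolding shifted_vandermonde_def sum.atMost_Suc_shift
    by (simp add: algebra_simps)
  also have "\<dots> = (\<Sum>j\<le>Suc N. ?t 0 j) + y * (\<Sum>j\<le>N. ?t 0 j) + 2 * y * (\<Sum>j\<le>N. ?t 1 j)"
    unfolding sum.atMost_Suc_shift by (simp add: sum.distrib sum_distrib_left del: sum.atMost_Suc)
  also have "\<dots> = shifted_vandermonde y N 0 + y * shifted_vandermonde y N 0 + 2 * y * shifted_vandermonde y N 1"
    by (simp only: shifted_vandermonde_extend[of N "Suc N"] shifted_vandermonde_extend[of N N] le_SucI order_refl)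
  finally show ?thesis by (simp add: algebra_simps)
qed

text \<open>By reflection, the weight of the nonnegative paths of length \<open>N\<close> from height \<open>0\<close> to
  height \<open>m\<close> with weight \<open>1\<close> for up, \<open>1 + y\<close> for level and \<open>y\<close> for down steps.\<close>

definition motzkin_prefix :: "'a::field \<Rightarrow> nat \<Rightarrow> nat \<Rightarrow> 'a" where
  "motzkin_prefix y N m = shifted_vandermonde y N m - y * shifted_vandermonde y N (Suc (Suc m))"

lemma motzkin_prefix_gt: "N < m \<Longrightarrow> motzkin_prefix y N m = 0"
  by (simp add: motzkin_prefix_def shifted_vandermonde_gt)

lemma motzkin_prefix_0: "motzkin_prefix y 0 m = (if m = 0 then 1 else 0)"
  by (cases m) (simp_all add: motzkin_prefix_def shifted_vandermonde_def)

text \<open>No path enters from below: by the same symmetry the reflected difference vanishes at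
  height -1.\<close>

lemma motzkin_prefix_Suc_0:
  "motzkin_prefix y (Suc N) 0 = (1 + y) * motzkin_prefix y N 0 + y * motzkin_prefix y N 1"
  by (simp add: motzkin_prefix_def shifted_vandermonde_Suc_0 shifted_vandermonde_Suc_Suc algebra_simps)

lemma motzkin_prefix_Suc_Suc:
  "motzkin_prefix y (Suc N) (Suc m) =
    (1 + y) * motzkin_prefix y N (Suc m) + motzkin_prefix y N m + y * motzkin_prefix y N (Suc (Suc m))"
  by (simp add: motzkin_prefix_def shifted_vandermonde_Suc_Suc algebra_simps)

lemma motzkin_prefix_eq_sum:
  assumes "m \<le> N"
  shows "(\<Sum>j=0..N - m. y ^ j * (of_nat (binom N (int j)) * of_nat (binom N (int (m + j)))
         - of_nat (binom N (int j - 1)) * of_nat (binom N (int (m + j + 1))))) = motzkin_prefix y N m"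
proof -
  let ?g = "\<lambda>j. y ^ j * (of_nat (binom N (int j - 1)) * of_nat (binom N (int (m + j + 1))))"
  have 1: "(\<Sum>j=0..N - m. y ^ j * (of_nat (binom N (int j)) * of_nat (binom N (int (m + j))))) = shifted_vandermonde y N m"
    unfolding shifted_vandermonde_def
    by (rule sum.mono_neutral_cong_left) (auto simp: binom_def binomial_eq_0 nat_add_distrib mult.assoc)
  have "(\<Sum>j=0..N - m. ?g j) = (\<Sum>j\<le>Suc N. ?g j)"
    using assms by (intro sum.mono_neutral_left) (auto simp: binom_def binomial_eq_0 nat_add_distrib)
  \<comment> \<open>The term \<open>j = 0\<close> vanishes because of the lower index -1; shifting
    \<open>j\<close> by one releases the factor \<open>y\<close>.\<close>
  also have "\<dots> = y * shifted_vandermonde y N (Suc (Suc m))"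
    unfolding sum.atMost_Suc_shift shifted_vandermonde_def sum_distrib_left
    by (auto simp: binom_def nat_add_distrib algebra_simps intro!: sum.cong)
  finally show ?thesis using 1
    by (simp add: motzkin_prefix_def right_diff_distrib sum_subtractf)
qed

text \<open>The part of the \<open>i\<close>-th summand of \<open>pasep_R\<close> that is free of
  \<open>N\<close>.\<close>

definition R_coeff :: "'a::field \<Rightarrow> 'a \<Rightarrow> nat \<Rightarrow> nat \<Rightarrow> 'a" where
  "R_coeff y q n i = (- y) ^ i * q ^ (Suc i choose 2) * q_binom q (n + i) i"

text \<open>The free bound \<open>K\<close> gives the sums for \<open>N\<close> and
  \<open>Suc N\<close> a common range; the extra terms vanish because a path of length
  \<open>N\<close> cannot climb above \<open>N\<close>.\<close>

lemma pasep_R_eq: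
  assumes "N \<le> K"
  shows "pasep_R N n y q = (\<Sum>i\<le>K. R_coeff y q n i * motzkin_prefix y N (n + 2 * i))"
proof (cases "n \<le> N")
  case True
  have "pasep_R N n y q = (\<Sum>i=0..(N - n) div 2. R_coeff y q n i * motzkin_prefix y N (n + 2 * i))"
    unfolding pasep_R_def
  proof (rule sum.cong)
    fix i assume "i \<in> {0..(N - n) div 2}"
    then have "n + 2 * i \<le> N" using True by auto
    from motzkin_prefix_eq_sum[OF this, of y]
    show "(- y) ^ i * q ^ ((i + 1) choose 2) * q_binom q (n + i) i *
      (\<Sum>j=0..N - n - 2 * i. y ^ j *
        (of_nat (binom N (int j)) * of_nat (binom N (int (n + 2 * i + j)))
         - of_nat (binom N (int j - 1)) * of_nat (binom N (int (n + 2 * i + j + 1)))))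
      = R_coeff y q n i * motzkin_prefix y N (n + 2 * i)"
      by (simp add: R_coeff_def)
  qed simp
  also have "\<dots> = (\<Sum>i\<le>K. R_coeff y q n i * motzkin_prefix y N (n + 2 * i))"
    using assms by (intro sum.mono_neutral_left) (auto simp: motzkin_prefix_gt)
  finally show ?thesis .
next
  case False
  then show ?thesis
    by (simp add: pasep_R_def motzkin_prefix_gt binom_def binomial_eq_0)
qed

lemma pasep_R_gt: "N < n \<Longrightarrow> pasep_R N n y q = 0"
  by (simp add: pasep_R_eq[of N N] motzkin_prefix_gt)

context
  fixes q :: "'a::field"
  assumes q_int_nonzero: "\<And>n. q_int q (Suc n) \<noteq> 0"
begin

lemma R_coeff_0: "R_coeff y q n 0 = 1"
  by (simp add: R_coeff_def q_binom_0 q_int_nonzero numeral_2_eq_2)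

lemma pasep_R_0: "pasep_R 0 n y q = (if n = 0 then 1 else 0)"
  by (simp add: pasep_R_eq[of 0 0] motzkin_prefix_0 R_coeff_0)

text \<open>Compares coefficients of \<open>motzkin_prefix y N (n + 2 * Suc i)\<close> in the
  recurrence of \<open>pasep_R\<close>. The q-Pascal rule reduces the left side, absorption the
  right side, to the same binomial.\<close>

lemma R_coeff_Suc:
  "R_coeff y q (Suc n) (Suc i) + y * R_coeff y q (Suc n) i =
    R_coeff y q n (Suc i) + y * (1 - q ^ (n + 2)) * R_coeff y q (n + 2) i"
proof -
  note nz = q_int_nonzero
  have c: "Suc (Suc i) choose 2 = (Suc i choose 2) + Suc i"
    by (simp add: numeral_2_eq_2)
  have p: "q_binom q (Suc (Suc (n + i))) (Suc i) =
    q_binom q (Suc (n + i)) (Suc i) + q ^ Suc n * q_binom q (Suc (n + i)) i"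
    using q_binom_Suc_Suc[OF nz, of "Suc (n + i)" i] by (simp add: Suc_diff_le)
  have a: "(1 - q ^ (n + 2)) * q_binom q (Suc (Suc (n + i))) i =
     (1 - q ^ (n + i + 2)) * q_binom q (Suc (n + i)) i"
    using q_binom_absorb_comp[OF nz, of "Suc (n + i)" i]
    by (simp add: mult.commute Suc_diff_le)
  have "R_coeff y q (Suc n) (Suc i) + y * R_coeff y q (Suc n) i - R_coeff y q n (Suc i)
     = y * (- y) ^ i * q ^ (Suc i choose 2) * ((1 - q ^ (n + i + 2)) * q_binom q (Suc (n + i)) i)"
    unfolding R_coeff_def c by (simp add: p power_add) (simp add: algebra_simps)
  also have "\<dots> = y * (1 - q ^ (n + 2)) * R_coeff y q (n + 2) i"
    unfolding a[symmetric] R_coeff_def by (simp add: algebra_simps)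
  finally show ?thesis by (simp add: algebra_simps)
qed

text \<open>The boundary version, where the term with index \<open>n - 1\<close> is absent.\<close>

lemma R_coeff_0_Suc:
  "R_coeff y q 0 (Suc i) + y * R_coeff y q 0 i = y * (1 - q) * R_coeff y q 1 i"
proof -
  note nz = q_int_nonzero
  have c: "Suc (Suc i) choose 2 = (Suc i choose 2) + Suc i"
    by (simp add: numeral_2_eq_2)
  have a: "(1 - q) * q_binom q (Suc i) i = 1 - q ^ Suc i"
    using q_binom_absorb_comp[OF nz, of i i] by (simp add: q_binom_self nz mult.commute)
  have "R_coeff y q 0 (Suc i) + y * R_coeff y q 0 i
     = y * (- y) ^ i * q ^ (Suc i choose 2) * (1 - q ^ Suc i)"
    unfolding R_coeff_def c by (simp add: q_binom_self[OF nz] power_add algebra_simps)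
  also have "\<dots> = y * (1 - q) * R_coeff y q 1 i"
    unfolding a[symmetric] R_coeff_def by (simp add: algebra_simps)
  finally show ?thesis .
qed

lemma pasep_R_Suc_0:
  "pasep_R (Suc N) 0 y q = (1 + y) * pasep_R N 0 y q + y * (1 - q) * pasep_R N 1 y q"
proof -
  let ?M = "motzkin_prefix y N" and ?c = "R_coeff y q"
  have "pasep_R (Suc N) 0 y q = ?c 0 0 * motzkin_prefix y (Suc N) 0 +
      (\<Sum>i\<le>N. ?c 0 (Suc i) * motzkin_prefix y (Suc N) (2 * Suc i))"
    by (simp add: pasep_R_eq[of "Suc N" "Suc N"] sum.atMost_Suc_shift del: sum.atMost_Suc)
  also have "\<dots> = (1 + y) * (?c 0 0 * ?M 0 + (\<Sum>i\<le>N. ?c 0 (Suc i) * ?M (2 * Suc i)))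
      + (\<Sum>i\<le>N. ?c 0 (Suc i) * ?M (2 * i + 1))
      + y * (?c 0 0 * ?M 1 + (\<Sum>i\<le>N. ?c 0 (Suc i) * ?M (2 * Suc i + 1)))"
    by (simp add: motzkin_prefix_Suc_0 motzkin_prefix_Suc_Suc algebra_simps sum.distrib sum_distrib_left)
  also have "?c 0 0 * ?M 0 + (\<Sum>i\<le>N. ?c 0 (Suc i) * ?M (2 * Suc i)) = pasep_R N 0 y q"
    by (simp add: pasep_R_eq[of N "Suc N"] sum.atMost_Suc_shift del: sum.atMost_Suc)
  also have "?c 0 0 * ?M 1 + (\<Sum>i\<le>N. ?c 0 (Suc i) * ?M (2 * Suc i + 1)) = (\<Sum>i\<le>Suc N. ?c 0 i * ?M (2 * i + 1))"
    unfolding sum.atMost_Suc_shift by simp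
  also have "\<dots> = (\<Sum>i\<le>N. ?c 0 i * ?M (2 * i + 1))"
    by (simp add: motzkin_prefix_gt)
  also have "(1 + y) * pasep_R N 0 y q + (\<Sum>i\<le>N. ?c 0 (Suc i) * ?M (2 * i + 1)) + y * (\<Sum>i\<le>N. ?c 0 i * ?M (2 * i + 1))
    = (1 + y) * pasep_R N 0 y q + (\<Sum>i\<le>N. (?c 0 (Suc i) + y * ?c 0 i) * ?M (2 * i + 1))"
    by (simp add: algebra_simps sum.distrib sum_distrib_left)
  also have "\<dots> = (1 + y) * pasep_R N 0 y q + y * (1 - q) * pasep_R N 1 y q"
    unfolding R_coeff_0_Suc by (simp add: pasep_R_eq[of N N] sum_distrib_left mult.assoc)
  finally show ?thesis .
qed

lemma pasep_R_Suc_Suc: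
  "pasep_R (Suc N) (Suc n) y q = (1 + y) * pasep_R N (Suc n) y q + pasep_R N n y q
    + y * (1 - q ^ (n + 2)) * pasep_R N (n + 2) y q"
proof -
  let ?M = "motzkin_prefix y N" and ?c = "R_coeff y q"
  have "pasep_R (Suc N) (Suc n) y q = (\<Sum>i\<le>Suc N. ?c (Suc n) i * motzkin_prefix y (Suc N) (Suc n + 2 * i))"
    by (simp only: pasep_R_eq[of "Suc N" "Suc N"] order_refl)
  also have "\<dots> = (1 + y) * (\<Sum>i\<le>Suc N. ?c (Suc n) i * ?M (Suc n + 2 * i))
      + (\<Sum>i\<le>Suc N. ?c (Suc n) i * ?M (n + 2 * i))
      + y * (\<Sum>i\<le>Suc N. ?c (Suc n) i * ?M (n + 2 * Suc i))"
    by (simp add: motzkin_prefix_Suc_Suc algebra_simps sum.distrib sum_distrib_left)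
  also have "(\<Sum>i\<le>Suc N. ?c (Suc n) i * ?M (Suc n + 2 * i)) = pasep_R N (Suc n) y q"
    by (simp only: pasep_R_eq[of N "Suc N"] order_refl le_SucI)
  also have "(\<Sum>i\<le>Suc N. ?c (Suc n) i * ?M (n + 2 * i)) =
      ?c (Suc n) 0 * ?M n + (\<Sum>i\<le>N. ?c (Suc n) (Suc i) * ?M (n + 2 * Suc i))"
    unfolding sum.atMost_Suc_shift by simp
  also have "(\<Sum>i\<le>Suc N. ?c (Suc n) i * ?M (n + 2 * Suc i)) = (\<Sum>i\<le>N. ?c (Suc n) i * ?M (n + 2 * Suc i))"
    by (simp add: motzkin_prefix_gt)
  also have "(1 + y) * pasep_R N (Suc n) y q
      + (?c (Suc n) 0 * ?M n + (\<Sum>i\<le>N. ?c (Suc n) (Suc i) * ?M (n + 2 * Suc i)))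
      + y * (\<Sum>i\<le>N. ?c (Suc n) i * ?M (n + 2 * Suc i))
    = (1 + y) * pasep_R N (Suc n) y q + ?c (Suc n) 0 * ?M n
      + (\<Sum>i\<le>N. (?c (Suc n) (Suc i) + y * ?c (Suc n) i) * ?M (n + 2 * Suc i))"
    by (simp add: algebra_simps sum.distrib sum_distrib_left)
  also have "\<dots> = (1 + y) * pasep_R N (Suc n) y q
      + (?c n 0 * ?M n + (\<Sum>i\<le>N. ?c n (Suc i) * ?M (n + 2 * Suc i)))
      + y * (1 - q ^ (n + 2)) * (\<Sum>i\<le>N. ?c (n + 2) i * ?M (n + 2 + 2 * i))"
    unfolding R_coeff_Suc by (simp add: R_coeff_0 distrib_right sum.distrib sum_distrib_left mult.assoc)
  also have "?c n 0 * ?M n + (\<Sum>i\<le>N. ?c n (Suc i) * ?M (n + 2 * Suc i)) = pasep_R N n y q"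
    by (simp add: pasep_R_eq[of N "Suc N"] sum.atMost_Suc_shift del: sum.atMost_Suc)
  also have "(\<Sum>i\<le>N. ?c (n + 2) i * ?M (n + 2 + 2 * i)) = pasep_R N (n + 2) y q"
    by (simp only: pasep_R_eq[of N N] order_refl)
  finally show ?thesis .
qed

end

section \<open>The \<open>q\<close>-Hermite recurrence\<close>

text \<open>A row \<open>v\<close> stands for a linear functional on \<open>K[e]\<close>, with \<open>v k\<close> its value at \<open>e\<^sup>k\<close>.
  Composed with left multiplication, \<open>e\<close> becomes the shift of \<open>v\<close> and \<open>d\<close> becomes the operator
  below, where \<open>b\<close> is the eigenvalue of \<open>d\<close> on the vector \<open>V\<close>.
  At \<open>k = 0\<close> the truncated \<open>k - 1\<close> has coefficient \<open>0\<close>.\<close>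

definition d_row :: "'a::field \<Rightarrow> 'a \<Rightarrow> (nat \<Rightarrow> 'a) \<Rightarrow> nat \<Rightarrow> 'a" where
  "d_row q b v k = q ^ k * b * v k + (1 - q ^ k) * v (k - 1)"

text \<open>The relation \<open>d e = q e d + (1 - q)\<close>, applied to
  \<open>e^k\<close>.\<close>

lemma d_row_Suc: "d_row q b v (Suc k) = q * d_row q b (\<lambda>k. v (Suc k)) k + (1 - q) * v k"
  by (cases k) (simp_all add: d_row_def algebra_simps)

lemma d_row_sum: "d_row q b (\<lambda>k. \<Sum>i\<in>A. c i * f i k) k = (\<Sum>i\<in>A. c i * d_row q b (f i) k)"
  by (simp add: d_row_def sum.distrib sum_distrib_left algebra_simps sum_subtractf)

lemma d_row_linear: "d_row q b (\<lambda>k. c * f k + c' * g k) k = c * d_row q b f k + c' * d_row q b g k"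
  by (simp add: d_row_def algebra_simps)

text \<open>The values \<open><W|d^j e^k|V>\<close>; the initial row \<open>a^k\<close> is
  \<open><W|\<close>, an eigenvector of \<open>e\<close>.\<close>

definition d_power_row :: "'a::field \<Rightarrow> 'a \<Rightarrow> 'a \<Rightarrow> nat \<Rightarrow> nat \<Rightarrow> 'a" where
  "d_power_row q a b j = (d_row q b ^^ j) (\<lambda>k. a ^ k)"

lemma d_power_row_Suc: "d_row q b (d_power_row q a b j) = d_power_row q a b (Suc j)"
  by (simp add: d_power_row_def)

lemma d_power_row_at_0: "d_power_row q a b j 0 = b ^ j"
  by (induction j) (simp_all add: d_power_row_def d_row_def)

text \<open>Reflects \<open>d^j e = q^j e d^j + (1 - q^j) d^(j-1)\<close>, with \<open>e\<close>
  acting on \<open><W|\<close> as \<open>a\<close>.\<close>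

lemma d_power_row_at_Suc:
  "d_power_row q a b j (Suc k) =
    q ^ j * a * d_power_row q a b j k + (1 - q ^ j) * d_power_row q a b (j - 1) k"
proof (induction j arbitrary: k)
  case 0
  show ?case by (simp add: d_power_row_def)
next
  case (Suc j)
  have "d_power_row q a b (Suc j) (Suc k)
      = q * d_row q b (\<lambda>k. d_power_row q a b j (Suc k)) k + (1 - q) * d_power_row q a b j k"
    by (simp add: d_row_Suc flip: d_power_row_Suc)
  also have "\<dots> = q * (q ^ j * a * d_power_row q a b (Suc j) k
      + (1 - q ^ j) * d_row q b (d_power_row q a b (j - 1)) k) + (1 - q) * d_power_row q a b j k"
    unfolding Suc d_row_linear d_power_row_Suc ..
  also have "\<dots> = q ^ Suc j * a * d_power_row q a b (Suc j) k + (1 - q ^ Suc j) * d_power_row q a b j k"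
    by (cases j) (simp_all add: d_power_row_Suc algebra_simps)
  finally show ?case by simp
qed

text \<open>The row of \<open>a\<^sup>k\<close> acted on by the \<open>q\<close>-Hermite normal form
  \<open>H\<^sub>n = \<Sum>\<^sub>i [n, i]\<^sub>q e\<^sup>i (y d)\<^bsup>n-i\<^esup>\<close>.\<close>

definition hermite_row :: "'a::field \<Rightarrow> 'a \<Rightarrow> 'a \<Rightarrow> 'a \<Rightarrow> nat \<Rightarrow> nat \<Rightarrow> 'a" where
  "hermite_row q y a b n k =
    (\<Sum>i\<le>n. q_binom q n i * a ^ i * y ^ (n - i) * d_power_row q a b (n - i) k)"

lemma hermite_row_at_0: "hermite_row q y a b n 0 = pasep_B n a b y q"
  by (simp add: hermite_row_def pasep_B_def d_power_row_at_0 power_mult_distrib mult.assoc atLeast0AtMost)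

lemma hermite_row_0: "q_binom q 0 0 = 1 \<Longrightarrow> hermite_row q y a b 0 k = a ^ k"
  by (simp add: hermite_row_def d_power_row_def)

text \<open>The action of \<open>y d + e + 1 + y = (1 - q)(y D + E)\<close>.\<close>

definition motzkin_row :: "'a::field \<Rightarrow> 'a \<Rightarrow> 'a \<Rightarrow> (nat \<Rightarrow> 'a) \<Rightarrow> nat \<Rightarrow> 'a" where
  "motzkin_row q y b v k = y * d_row q b v k + v (Suc k) + (1 + y) * v k"

lemma motzkin_row_sum:
  "motzkin_row q y b (\<lambda>k. \<Sum>i\<in>A. c i * f i k) k = (\<Sum>i\<in>A. c i * motzkin_row q y b (f i) k)"
  by (simp add: motzkin_row_def d_row_sum sum.distrib sum_distrib_left algebra_simps)

context
  fixes q :: "'a::field"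
  assumes q_int_nonzero: "\<And>n. q_int q (Suc n) \<noteq> 0"
begin

text \<open>Moving \<open>e\<close> to the left through \<open>d^(n-i)\<close> leaves a main term,
  which joins the \<open>y d\<close> term by the q-Pascal rule, and a lower term, which absorption
  turns into \<open>H_(n-1)\<close>.\<close>

lemma hermite_row_recurrence:
  "y * d_row q b (hermite_row q y a b n) k + hermite_row q y a b n (Suc k)
    = hermite_row q y a b (Suc n) k + y * (1 - q ^ n) * hermite_row q y a b (n - 1) k"
proof -
  note nz = q_int_nonzero
  let ?P = "d_power_row q a b" and ?c = "\<lambda>i. q_binom q n i * a ^ i * y ^ (n - i)"
  let ?e = "\<lambda>i. q_binom q n i * a ^ i * y ^ (Suc n - i) * ?P (Suc n - i) k"
  let ?f = "\<lambda>i. q ^ (n - i) * q_binom q n i * a ^ Suc i * y ^ (n - i) * ?P (n - i) k"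
  have d: "y * d_row q b (hermite_row q y a b n) k = (\<Sum>i\<le>n. ?e i)"
    unfolding hermite_row_def d_row_sum d_power_row_Suc sum_distrib_left
    by (intro sum.cong) (auto simp: Suc_diff_le)
  have e: "hermite_row q y a b n (Suc k) = (\<Sum>i\<le>n. ?f i)
      + (\<Sum>i\<le>n. ?c i * (1 - q ^ (n - i)) * ?P (n - i - 1) k)"
    unfolding hermite_row_def d_power_row_at_Suc
    by (simp add: algebra_simps sum.distrib sum_subtractf)
  have low: "(\<Sum>i\<le>n. ?c i * (1 - q ^ (n - i)) * ?P (n - i - 1) k)
      = y * (1 - q ^ n) * hermite_row q y a b (n - 1) k"
  proof (cases n)
    case (Suc m)
    have "(\<Sum>i\<le>n. ?c i * (1 - q ^ (n - i)) * ?P (n - i - 1) k)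
        = (\<Sum>i\<le>m. (q_binom q (Suc m) i * (1 - q ^ (Suc m - i))) * a ^ i * y ^ (Suc m - i) * ?P (m - i) k)"
      by (simp add: Suc mult_ac)
    also have "\<dots> = (\<Sum>i\<le>m. (1 - q ^ Suc m) * q_binom q m i * a ^ i * (y * y ^ (m - i)) * ?P (m - i) k)"
      unfolding q_binom_absorb_comp[OF nz] by (intro sum.cong) (auto simp: Suc_diff_le)
    also have "\<dots> = y * (1 - q ^ n) * hermite_row q y a b (n - 1) k"
      unfolding Suc hermite_row_def sum_distrib_left by (intro sum.cong) (simp_all add: mult_ac)
    finally show ?thesis .
  qed simp
  have "hermite_row q y a b (Suc n) k = ?e 0 + (\<Sum>i\<le>n. ?e (Suc i) + ?f i)"
    unfolding hermite_row_def sum.atMost_Suc_shift q_binom_Suc_Suc[OF nz]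
    by (simp add: q_binom_0 nz algebra_simps)
  also have "\<dots> = (\<Sum>i\<le>Suc n. ?e i) + (\<Sum>i\<le>n. ?f i)"
    unfolding sum.atMost_Suc_shift by (simp add: sum.distrib)
  also have "(\<Sum>i\<le>Suc n. ?e i) = (\<Sum>i\<le>n. ?e i)"
    by (simp add: q_binom_gt)
  finally show ?thesis unfolding d e low by (simp add: add.assoc)
qed

lemma motzkin_row_hermite_row:
  "motzkin_row q y b (hermite_row q y a b n) k = hermite_row q y a b (Suc n) k
     + (1 + y) * hermite_row q y a b n k + y * (1 - q ^ n) * hermite_row q y a b (n - 1) k"
  using hermite_row_recurrence[of y b a n k] by (simp add: motzkin_row_def)

lemma motzkin_row_power:
  "(motzkin_row q y b ^^ N) (\<lambda>k. a ^ k) k = (\<Sum>n\<le>N. pasep_R N n y q * hermite_row q y a b n k)"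
proof (induction N arbitrary: k)
  case 0
  show ?case by (simp add: pasep_R_0 q_int_nonzero hermite_row_0 q_binom_0)
next
  case (Suc N)
  let ?H = "\<lambda>n. hermite_row q y a b n k" and ?R = "\<lambda>n. pasep_R N n y q"
  have "(motzkin_row q y b ^^ N) (\<lambda>k. a ^ k) = (\<lambda>k. \<Sum>n\<le>N. pasep_R N n y q * hermite_row q y a b n k)"
    by (simp add: Suc fun_eq_iff)
  then have "(motzkin_row q y b ^^ Suc N) (\<lambda>k. a ^ k) k
      = (\<Sum>n\<le>N. ?R n * (?H (Suc n) + (1 + y) * ?H n + y * (1 - q ^ n) * ?H (n - 1)))"
    by (simp add: motzkin_row_sum motzkin_row_hermite_row)
  also have "\<dots> = (\<Sum>n\<le>N. ?R n * ?H (Suc n)) + (1 + y) * (\<Sum>n\<le>N. ?R n * ?H n)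
      + (\<Sum>n\<le>N. y * (1 - q ^ n) * ?R n * ?H (n - 1))"
    by (simp add: algebra_simps sum.distrib sum_distrib_left sum_subtractf)
  also have "(\<Sum>n\<le>N. ?R n * ?H n) = (\<Sum>n\<le>Suc N. ?R n * ?H n)"
    by (simp add: pasep_R_gt)
  also have "\<dots> = ?R 0 * ?H 0 + (\<Sum>n\<le>N. ?R (Suc n) * ?H (Suc n))"
    by (rule sum.atMost_Suc_shift)
  \<comment> \<open>Two zero terms are appended so that the index can be shifted twice; the term
    \<open>n = 0\<close> drops out through \<open>1 - q ^ 0\<close>.\<close>
  also have "(\<Sum>n\<le>N. y * (1 - q ^ n) * ?R n * ?H (n - 1)) = (\<Sum>n\<le>Suc (Suc N). y * (1 - q ^ n) * ?R n * ?H (n - 1))"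
    by (simp add: pasep_R_gt)
  also have "\<dots> = y * (1 - q) * ?R 1 * ?H 0 + (\<Sum>n\<le>N. y * (1 - q ^ (n + 2)) * ?R (n + 2) * ?H (Suc n))"
    unfolding sum.atMost_Suc_shift by simp
  also have "(\<Sum>n\<le>N. ?R n * ?H (Suc n)) + (1 + y) * (?R 0 * ?H 0 + (\<Sum>n\<le>N. ?R (Suc n) * ?H (Suc n)))
     + (y * (1 - q) * ?R 1 * ?H 0 + (\<Sum>n\<le>N. y * (1 - q ^ (n + 2)) * ?R (n + 2) * ?H (Suc n)))
    = ((1 + y) * ?R 0 + y * (1 - q) * ?R 1) * ?H 0
      + (\<Sum>n\<le>N. ((1 + y) * ?R (Suc n) + ?R n + y * (1 - q ^ (n + 2)) * ?R (n + 2)) * ?H (Suc n))"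
    by (simp add: distrib_right distrib_left sum.distrib sum_distrib_left mult.assoc)
  also have "\<dots> = (\<Sum>n\<le>Suc N. pasep_R (Suc N) n y q * ?H n)"
    unfolding sum.atMost_Suc_shift pasep_R_Suc_0[OF q_int_nonzero] pasep_R_Suc_Suc[OF q_int_nonzero] ..
  finally show ?case .
qed

end

section \<open>Representation of the algebra on rows\<close>

lemma poly_mapping_add_induct [case_names zero single add]:
  assumes "P 0"
    and "\<And>k c. P (Poly_Mapping.single k c)"
    and "\<And>f g. P f \<Longrightarrow> P g \<Longrightarrow> P (f + g)"
  shows "P (f :: 'a \<Rightarrow>\<^sub>0 'b::monoid_add)"
proof (induction f rule: Poly_Mapping.update_induct)
  case const
  show ?case by fact
next
  case (update f k c)
  have "Poly_Mapping.update k c f = f + Poly_Mapping.single k c"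
    using update(1)
    by (intro poly_mapping_eqI)
      (auto simp: lookup_update lookup_add lookup_single when_def not_in_keys_iff_lookup_eq_zero)
  then show ?case using update assms by simp
qed

lemma of_zyq_to_fract: "of_zyq c = to_fract [:[:c:]:]"
  by (simp add: of_zyq_def to_fract_def)

lemma of_zyq_0 [simp]: "of_zyq 0 = 0"
  and of_zyq_1 [simp]: "of_zyq 1 = 1"
  and of_zyq_add: "of_zyq (a + b) = of_zyq a + of_zyq b"
  and of_zyq_diff: "of_zyq (a - b) = of_zyq a - of_zyq b"
  and of_zyq_mult: "of_zyq (a * b) = of_zyq a * of_zyq b"
  and of_zyq_eq_0_iff: "of_zyq a = 0 \<longleftrightarrow> a = 0"
  by (simp_all add: of_zyq_to_fract flip: to_fract_add to_fract_diff to_fract_mult one_pCons)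

lemma of_zyq_power: "of_zyq (a ^ n) = of_zyq a ^ n"
  by (induction n) (simp_all add: of_zyq_mult)

lemma of_zyq_sum: "of_zyq (sum f A) = (\<Sum>x\<in>A. of_zyq (f x))"
  by (induction A rule: infinite_finite_induct) (simp_all add: of_zyq_add)

lemma q_int_ind_q_nonzero: "q_int ind_q (Suc n) \<noteq> 0"
proof -
  have "q_int ind_q (Suc n) = of_zyq (\<Sum>i<Suc n. zyq_q ^ i)"
    by (simp only: q_int_def ind_q_def of_zyq_sum of_zyq_power)
  \<comment> \<open>Specialising to \<open>y = 0\<close>, \<open>q = 1\<close> shows that the
    polynomial is nonzero.\<close>
  moreover have "poly (poly (\<Sum>i<Suc n. zyq_q ^ i) 0) 1 = int (Suc n)"
    by (simp add: poly_sum poly_power zyq_q_def)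
  then have "(\<Sum>i<Suc n. zyq_q ^ i) \<noteq> 0"
    by (metis of_nat_eq_0_iff nat.distinct(1) poly_0)
  ultimately show ?thesis by (simp add: of_zyq_eq_0_iff)
qed

lemma one_minus_ind_q_nonzero: "1 - ind_q \<noteq> 0"
proof -
  have "1 - ind_q = of_zyq (1 - zyq_q)"
    by (simp add: ind_q_def of_zyq_diff)
  moreover have "poly (poly (1 - zyq_q) 0) 0 = 1"
    by (simp add: zyq_q_def)
  then have "1 - zyq_q \<noteq> 0" by force
  ultimately show ?thesis by (simp add: of_zyq_eq_0_iff)
qed

lemma ind_alpha_nonzero: "ind_alpha \<noteq> 0"
  by (simp add: ind_alpha_def flip: to_fract_def)

lemma ind_beta_nonzero: "ind_beta \<noteq> 0"
  by (simp add: ind_beta_def flip: to_fract_def)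

text \<open>Letters act on rows from the right: a word is applied from its first letter to its last.\<close>

fun letter_row :: "letter \<Rightarrow> (nat \<Rightarrow> ratfun) \<Rightarrow> nat \<Rightarrow> ratfun" where
  "letter_row LD v k = (v k + d_row ind_q beta_tilde v k) / (1 - ind_q)"
| "letter_row LE v k = (v k + v (Suc k)) / (1 - ind_q)"

text \<open>Since the first letter acts first, \<open>letter_row LE (letter_row LD v)\<close> is the
  action of \<open>D E\<close>. Substituting \<open>D = (1 + d)/(1 - q)\<close> and
  \<open>E = (1 + e)/(1 - q)\<close> reduces the claim to \<open>d_row_Suc\<close>.\<close>

lemma letter_row_relation:
  "letter_row LE (letter_row LD v) k - ind_q * letter_row LD (letter_row LE v) k
    = letter_row LD v k + letter_row LE v k"
proof -
  note nz = one_minus_ind_q_nonzero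
  let ?d = "d_row ind_q beta_tilde"
  have de: "letter_row LE (letter_row LD v) k
      = (v k + ?d v k + v (Suc k) + ?d v (Suc k)) / (1 - ind_q)\<^sup>2"
    by (simp add: power2_eq_square add_divide_distrib)
  have LE: "letter_row LE v = (\<lambda>k. 1 / (1 - ind_q) * v k + 1 / (1 - ind_q) * v (Suc k))"
    by (simp add: fun_eq_iff add_divide_distrib)
  have ed: "letter_row LD (letter_row LE v) k
      = (v k + ?d v k + v (Suc k) + ?d (\<lambda>k. v (Suc k)) k) / (1 - ind_q)\<^sup>2"
    unfolding letter_row.simps(1) LE d_row_linear
    by (simp add: power2_eq_square add_divide_distrib)
  show ?thesis
    unfolding de ed using nz
    by (simp add: d_row_Suc divide_simps power2_eq_square) (simp add: algebra_simps)
qed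

definition word_row :: "word \<Rightarrow> (nat \<Rightarrow> ratfun) \<Rightarrow> nat \<Rightarrow> ratfun" where
  "word_row w = fold letter_row (letters w)"

lemma word_row_0: "word_row 0 v = v"
  by (simp add: word_row_def zero_word_def)

lemma word_row_add: "word_row (u + w) v = word_row w (word_row u v)"
  by (simp add: word_row_def plus_word_def)

lemma letter_row_linear:
  "letter_row l (\<lambda>k. c * f k + c' * g k) = (\<lambda>k. c * letter_row l f k + c' * letter_row l g k)"
  by (cases l) (simp_all add: fun_eq_iff d_row_linear add_divide_distrib algebra_simps)

lemma word_row_linear:
  "word_row w (\<lambda>k. c * f k + c' * g k) = (\<lambda>k. c * word_row w f k + c' * word_row w g k)"
proof -
  have "fold letter_row ls (\<lambda>k. c * f k + c' * g k)
      = (\<lambda>k. c * fold letter_row ls f k + c' * fold letter_row ls g k)" for ls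
    by (induction ls arbitrary: f g) (simp_all add: letter_row_linear)
  then show ?thesis by (simp add: word_row_def)
qed

definition free_row :: "free_alg \<Rightarrow> (nat \<Rightarrow> ratfun) \<Rightarrow> nat \<Rightarrow> ratfun" where
  "free_row a v k =
    (\<Sum>w\<in>Poly_Mapping.keys a. of_zyq (Poly_Mapping.lookup a w) * word_row w v k)"

lemma free_row_single: "free_row (Poly_Mapping.single w c) v k = of_zyq c * word_row w v k"
  by (simp add: free_row_def)

lemma free_row_0: "free_row 0 v k = 0"
  by (simp add: free_row_def)

lemma free_row_add: "free_row (a + b) v k = free_row a v k + free_row b v k"
  unfolding free_row_def
  by (rule setsum_keys_plus_distrib) (simp_all add: of_zyq_add distrib_right)

lemma free_row_diff: "free_row (a - b) v k = free_row a v k - free_row b v k"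
  using free_row_add[of "a - b" b v k] by simp

lemma free_row_linear:
  "free_row a (\<lambda>k. c * f k + c' * g k) k = c * free_row a f k + c' * free_row a g k"
  by (simp add: free_row_def word_row_linear sum_distrib_left sum.distrib algebra_simps)

lemma free_row_row_0: "free_row a (\<lambda>_. 0) k = 0"
  using free_row_linear[of a 0 "\<lambda>_. 0" 0 "\<lambda>_. 0" k] by simp

lemma free_row_mult: "free_row (a * b) v = free_row b (free_row a v)"
proof (induction a rule: poly_mapping_add_induct)
  case zero
  show ?case by (simp add: free_row_0 [abs_def] free_row_row_0 fun_eq_iff)
next
  case (single u c)
  have u: "free_row (Poly_Mapping.single u c) v = (\<lambda>k. of_zyq c * word_row u v k + 0 * v k)"
    by (simp add: free_row_single fun_eq_iff)
  show ?case
    unfolding u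
  proof (induction b rule: poly_mapping_add_induct)
    case zero
    show ?case by (simp add: free_row_0 fun_eq_iff)
  next
    case (single w d)
    show ?case
      unfolding mult_single fun_eq_iff free_row_linear
      by (simp add: free_row_single word_row_add of_zyq_mult)
  next
    case (add b b')
    then show ?case by (simp add: distrib_left free_row_add fun_eq_iff)
  qed
next
  case (add a a')
  have sum: "free_row (a + a') v = (\<lambda>k. 1 * free_row a v k + 1 * free_row a' v k)"
    by (simp add: free_row_add fun_eq_iff)
  have "free_row ((a + a') * b) v k = free_row b (free_row (a + a') v) k" for k
    unfolding distrib_right free_row_add add sum free_row_linear by simp
  then show ?case by (rule ext)
qed

lemma free_row_scalar: "free_row (free_scalar c) v k = of_zyq c * v k"
  by (simp add: free_scalar_def free_row_single word_row_0)

lemma free_row_D: "free_row free_D v = letter_row LD v"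
  by (simp add: fun_eq_iff free_D_def free_row_single word_row_def)

lemma free_row_E: "free_row free_E v = letter_row LE v"
  by (simp add: fun_eq_iff free_E_def free_row_single word_row_def)

lemma free_row_1: "free_row 1 v = v"
  by (simp add: fun_eq_iff free_row_single word_row_0 flip: single_one)

text \<open>Makes the action descend to the quotient algebra.\<close>

lemma free_row_pasep_ideal: "a \<in> pasep_ideal \<Longrightarrow> free_row a v k = 0"
proof (induction arbitrary: v k rule: pasep_ideal.induct)
  case rel
  have "free_row (free_scalar zyq_q) v = (\<lambda>k. ind_q * v k + 0 * v k)"
    by (simp add: fun_eq_iff free_row_scalar ind_q_def)
  then have "free_row (free_scalar zyq_q * free_E * free_D) v k
      = ind_q * letter_row LD (letter_row LE v) k"
    by (simp only: free_row_mult free_row_D free_row_E letter_row_linear)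
  then show ?case
    by (simp only: free_row_diff free_row_add free_row_mult free_row_D free_row_E letter_row_relation)
next
  case zero
  show ?case by (rule free_row_0)
next
  case (add a b)
  then show ?case by (simp add: free_row_add)
next
  case (mult_left a x)
  then show ?case by (simp add: free_row_mult)
next
  case (mult_right a x)
  then have "free_row a v = (\<lambda>_. 0)" by (simp add: fun_eq_iff)
  then show ?case by (simp add: free_row_mult free_row_row_0)
qed

lift_definition alg_row :: "pasep_alg \<Rightarrow> (nat \<Rightarrow> ratfun) \<Rightarrow> nat \<Rightarrow> ratfun" is free_row
proof -
  fix a b assume "pasep_cong a b"
  then have "free_row (a - b) v k = 0" for v k
    by (simp add: pasep_cong_def free_row_pasep_ideal)
  then show "free_row a = free_row b"
    by (simp add: fun_eq_iff free_row_diff)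
qed

lemma alg_row_0: "alg_row 0 v k = 0"
  by transfer (rule free_row_0)

lemma alg_row_1: "alg_row 1 v = v"
  by transfer (rule free_row_1)

lemma alg_row_add: "alg_row (a + b) v k = alg_row a v k + alg_row b v k"
  by transfer (rule free_row_add)

lemma alg_row_mult: "alg_row (a * b) v = alg_row b (alg_row a v)"
  by transfer (rule free_row_mult)

lemma alg_row_scalar: "alg_row (alg_scalar c) v k = of_zyq c * v k"
  by transfer (rule free_row_scalar)

lemma alg_row_D: "alg_row alg_D v = letter_row LD v"
  by transfer (rule free_row_D)

lemma alg_row_E: "alg_row alg_E v = letter_row LE v"
  by transfer (rule free_row_E)

lemma alg_row_power: "alg_row (a ^ n) v = (alg_row a ^^ n) v"
  by (induction n arbitrary: v) (simp_all add: alg_row_1 alg_row_mult funpow_swap1)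

lemma alg_row_sum: "alg_row (sum f A) v k = (\<Sum>x\<in>A. alg_row (f x) v k)"
  by (induction A rule: infinite_finite_induct) (simp_all add: alg_row_0 alg_row_add)

lemma alg_row_linear:
  "alg_row a (\<lambda>k. c * f k + c' * g k) k = c * alg_row a f k + c' * alg_row a g k"
  by transfer (rule free_row_linear)

lemma alg_row_scale: "alg_row a (\<lambda>k. c * f k) k = c * alg_row a f k"
  using alg_row_linear[of a c f 0 f k] by simp

text \<open>The row \<open>alpha_tilde ^ k\<close> is \<open><W|\<close>: as
  \<open>1 + alpha_tilde = (1 - q)/\<alpha>\<close>, its eigenvalue under \<open>E\<close> is
  \<open>1/\<alpha>\<close>. The factor \<open>c\<close> admits the induction.\<close>

lemma alg_row_E_power:
  "alg_row (alg_E ^ i) (\<lambda>k. c * alpha_tilde ^ k) = (\<lambda>k. c * inverse ind_alpha ^ i * alpha_tilde ^ k)"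
proof (induction i arbitrary: c)
  case 0
  show ?case by (simp add: alg_row_1)
next
  case (Suc i)
  have a: "1 + alpha_tilde = (1 - ind_q) * inverse ind_alpha"
    by (simp add: alpha_tilde_def divide_inverse)
  have "(c * alpha_tilde ^ k + c * alpha_tilde ^ Suc k) / (1 - ind_q) = c * inverse ind_alpha * alpha_tilde ^ k" for k
  proof -
    have "c * alpha_tilde ^ k + c * alpha_tilde ^ Suc k = c * alpha_tilde ^ k * (1 + alpha_tilde)"
      by (simp add: algebra_simps)
    then show ?thesis unfolding a using one_minus_ind_q_nonzero by simp
  qed
  then have "alg_row alg_E (\<lambda>k. c * alpha_tilde ^ k) = (\<lambda>k. c * inverse ind_alpha * alpha_tilde ^ k)"
    by (simp add: fun_eq_iff alg_row_E)
  then show ?case by (simp only: power_Suc alg_row_mult Suc) (simp only: mult.assoc)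
qed

text \<open>Taking entry 0 of a row is pairing it with \<open>|V>\<close>, on which \<open>D\<close>
  acts as \<open>1/\<beta>\<close>.\<close>

lemma alg_row_D_power: "alg_row (alg_D ^ j) v 0 = inverse ind_beta ^ j * v 0"
proof (induction j arbitrary: v)
  case 0
  show ?case by (simp add: alg_row_1)
next
  case (Suc j)
  have b: "1 + beta_tilde = (1 - ind_q) * inverse ind_beta"
    by (simp add: beta_tilde_def divide_inverse)
  have "alg_row alg_D v 0 = (v 0 * (1 + beta_tilde)) / (1 - ind_q)"
    by (simp add: alg_row_D d_row_def algebra_simps)
  also have "\<dots> = inverse ind_beta * v 0"
    unfolding b using one_minus_ind_q_nonzero by simp
  finally show ?case by (simp add: alg_row_mult Suc)
qed

section \<open>Normal forms\<close>

definition normal_sum :: "((nat \<times> nat) \<Rightarrow>\<^sub>0 zyq) \<Rightarrow> pasep_alg" where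
  "normal_sum c = (\<Sum>(i, j)\<in>Poly_Mapping.keys c.
     alg_scalar (Poly_Mapping.lookup c (i, j)) * alg_E ^ i * alg_D ^ j)"

definition partition_value :: "((nat \<times> nat) \<Rightarrow>\<^sub>0 zyq) \<Rightarrow> ratfun" where
  "partition_value c = (\<Sum>(i, j)\<in>Poly_Mapping.keys c.
     of_zyq (Poly_Mapping.lookup c (i, j)) * inverse ind_alpha ^ i * inverse ind_beta ^ j)"

lemma alg_row_normal_sum: "alg_row (normal_sum c) (\<lambda>k. alpha_tilde ^ k) 0 = partition_value c"
proof -
  have "alg_row (alg_scalar d * alg_E ^ i * alg_D ^ j) (\<lambda>k. alpha_tilde ^ k) 0
      = of_zyq d * inverse ind_alpha ^ i * inverse ind_beta ^ j" for d i j
  proof -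
    have "alg_row (alg_scalar d) (\<lambda>k. alpha_tilde ^ k) = (\<lambda>k. of_zyq d * alpha_tilde ^ k)"
      by (simp add: fun_eq_iff alg_row_scalar)
    then show ?thesis by (simp add: alg_row_mult alg_row_E_power alg_row_D_power)
  qed
  then show ?thesis
    by (simp add: normal_sum_def partition_value_def alg_row_sum case_prod_beta)
qed

lemma partition_value_diff: "partition_value (c - c') = partition_value c - partition_value c'"
proof -
  have "partition_value (a + b) = partition_value a + partition_value b" for a b
    unfolding partition_value_def case_prod_beta prod.collapse
    by (rule setsum_keys_plus_distrib) (simp_all add: of_zyq_add distrib_right)
  from this[of "c - c'" c'] show ?thesis by simp
qed

text \<open>This replaces the linear independence of the words \<open>E\<^sup>i D\<^sup>j\<close>: the monomials
  \<open>\<alpha>\<^sup>-\<^sup>i \<beta>\<^sup>-\<^sup>j\<close> are already independent over \<open>\<int>[y,q]\<close>.\<close>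

lemma partition_value_eq_0_imp:
  assumes "partition_value c = 0"
  shows "c = 0"
proof (rule ccontr)
  assume "c \<noteq> 0"
  then obtain i0 j0 where k0: "(i0, j0) \<in> Poly_Mapping.keys c"
    by (metis ex_in_conv keys_eq_empty surj_pair)
  define m where "m = Max (fst ` Poly_Mapping.keys c)"
  define n where "n = Max (snd ` Poly_Mapping.keys c)"
  have bound: "fst x \<le> m" "snd x \<le> n" if "x \<in> Poly_Mapping.keys c" for x
    using that by (simp_all add: m_def n_def)
  \<comment> \<open>\<open>P\<close> is the value multiplied by \<open>\<alpha>^m \<beta>^n\<close>,
    which clears all denominators.\<close>
  define P where "P = (\<Sum>x\<in>Poly_Mapping.keys c.
    monom (monom (Poly_Mapping.lookup c x) (m - fst x)) (n - snd x))"
  have alpha: "ind_alpha ^ i = to_fract [:monom 1 i:]" for i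
    by (induction i) (simp_all add: ind_alpha_def monom_Suc flip: to_fract_def to_fract_mult one_pCons)
  have beta: "ind_beta ^ i = to_fract (monom 1 i)" for i
    by (induction i) (simp_all add: ind_beta_def monom_Suc flip: to_fract_def to_fract_mult)
  have "to_fract P = (\<Sum>x\<in>Poly_Mapping.keys c.
      of_zyq (Poly_Mapping.lookup c x) * ind_alpha ^ (m - fst x) * ind_beta ^ (n - snd x))"
    unfolding P_def to_fract_sum
    by (intro sum.cong)
      (simp_all add: of_zyq_to_fract alpha beta smult_monom flip: to_fract_mult)
  also have "\<dots> = (\<Sum>x\<in>Poly_Mapping.keys c. ind_alpha ^ m * ind_beta ^ n *
      (of_zyq (Poly_Mapping.lookup c x) * inverse ind_alpha ^ fst x * inverse ind_beta ^ snd x))"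
    using bound ind_alpha_nonzero ind_beta_nonzero
    by (intro sum.cong) (simp_all add: power_diff power_inverse divide_inverse mult_ac)
  also have "\<dots> = ind_alpha ^ m * ind_beta ^ n * partition_value c"
    by (simp add: partition_value_def case_prod_beta sum_distrib_left)
  finally have "P = 0" using assms by simp
  have "coeff (coeff P (n - j0)) (m - i0) =
    (\<Sum>x\<in>Poly_Mapping.keys c. if x = (i0, j0) then Poly_Mapping.lookup c x else 0)"
    unfolding P_def coeff_sum
  proof (intro sum.cong refl)
    \<comment> \<open>By the bounds, \<open>m - i\<close> and \<open>n - j\<close> are not
      truncated, so distinct keys give distinct monomials.\<close>
    fix x assume "x \<in> Poly_Mapping.keys c"
    from bound[OF this] bound[OF k0]
    show "coeff (coeff (monom (monom (Poly_Mapping.lookup c x) (m - fst x)) (n - snd x)) (n - j0)) (m - i0)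
      = (if x = (i0, j0) then Poly_Mapping.lookup c x else 0)"
      by (cases x) auto
  qed
  also have "\<dots> = Poly_Mapping.lookup c (i0, j0)"
    using k0 by simp
  finally show False
    using k0 \<open>P = 0\<close> by (simp add: in_keys_iff)
qed

lemma normal_sum_inject: "normal_sum c = normal_sum c' \<Longrightarrow> c = c'"
  by (metis alg_row_normal_sum eq_iff_diff_eq_0 partition_value_diff partition_value_eq_0_imp)

lemma normal_coeffs_normal_sum: "normal_coeffs (normal_sum c) = c"
  unfolding normal_coeffs_def normal_sum_def[symmetric]
  by (rule the_equality) (auto dest: normal_sum_inject)

section \<open>Existence of normal forms\<close>

lemma alg_scalar_0: "alg_scalar 0 = 0"
  by transfer (simp add: free_scalar_def pasep_cong_def pasep_ideal.zero)

lemma alg_scalar_1: "alg_scalar 1 = 1"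
  by transfer (simp add: free_scalar_def pasep_cong_def pasep_ideal.zero)

lemma alg_scalar_add: "alg_scalar (c + d) = alg_scalar c + alg_scalar d"
  by transfer (simp add: free_scalar_def single_add pasep_cong_def pasep_ideal.zero)

lemma alg_scalar_mult: "alg_scalar (c * d) = alg_scalar c * alg_scalar d"
  by transfer (simp add: free_scalar_def mult_single pasep_cong_def pasep_ideal.zero)

lemma alg_scalar_commute_D: "alg_D * alg_scalar c = alg_scalar c * alg_D"
  by transfer (simp add: free_scalar_def free_D_def mult_single pasep_cong_def pasep_ideal.zero)

lemma alg_scalar_commute_E: "alg_E * alg_scalar c = alg_scalar c * alg_E"
  by transfer (simp add: free_scalar_def free_E_def mult_single pasep_cong_def pasep_ideal.zero)

lemma normal_sum_0: "normal_sum 0 = 0"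
  by (simp add: normal_sum_def)

lemma normal_sum_single:
  "normal_sum (Poly_Mapping.single (i, j) c) = alg_scalar c * alg_E ^ i * alg_D ^ j"
  by (simp add: normal_sum_def alg_scalar_0)

lemma normal_sum_add: "normal_sum (c + c') = normal_sum c + normal_sum c'"
  unfolding normal_sum_def case_prod_beta prod.collapse
  by (rule setsum_keys_plus_distrib) (simp_all add: alg_scalar_0 alg_scalar_add distrib_right)

lemma range_normal_sum_add:
  "a \<in> range normal_sum \<Longrightarrow> b \<in> range normal_sum \<Longrightarrow> a + b \<in> range normal_sum"
  by (auto simp flip: normal_sum_add)

text \<open>Left multiplication by \<open>x\<close> commutes with scalars, so monomials
  suffice.\<close>

lemma range_normal_sum_mult:
  assumes "\<And>c. x * alg_scalar c = alg_scalar c * x"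
    and "\<And>c i j. alg_scalar c * (x * (alg_E ^ i * alg_D ^ j)) \<in> range normal_sum"
    and "a \<in> range normal_sum"
  shows "x * a \<in> range normal_sum"
proof -
  have "x * normal_sum c \<in> range normal_sum" for c
  proof (induction c rule: poly_mapping_add_induct)
    case zero
    show ?case by (metis mult_zero_right normal_sum_0 rangeI)
  next
    case (single k c)
    obtain i j where "k = (i, j)" by force
    then show ?case
      using assms(1)[of c] assms(2)[of c i j] by (metis mult.assoc normal_sum_single)
  next
    case (add c c')
    then show ?case by (simp add: normal_sum_add distrib_left range_normal_sum_add)
  qed
  with assms(3) show ?thesis by blast
qed

lemma range_normal_sum_scalar:
  "a \<in> range normal_sum \<Longrightarrow> alg_scalar c * a \<in> range normal_sum"
proof (rule range_normal_sum_mult)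
  show "alg_scalar c * alg_scalar d = alg_scalar d * alg_scalar c" for d
    by (metis alg_scalar_mult mult.commute)
  show "alg_scalar d * (alg_scalar c * (alg_E ^ i * alg_D ^ j)) \<in> range normal_sum" for d i j
    by (metis alg_scalar_mult mult.assoc normal_sum_single rangeI)
qed

lemma range_normal_sum_E: "a \<in> range normal_sum \<Longrightarrow> alg_E * a \<in> range normal_sum"
proof (rule range_normal_sum_mult)
  show "alg_scalar d * (alg_E * (alg_E ^ i * alg_D ^ j)) \<in> range normal_sum" for d i j
    by (metis mult.assoc power_Suc normal_sum_single rangeI)
qed (rule alg_scalar_commute_E)

lemma monomial_in_range_normal_sum: "alg_E ^ i * alg_D ^ j \<in> range normal_sum"
  by (metis alg_scalar_1 mult_1 normal_sum_single rangeI)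

lemma range_normal_sum_D: "a \<in> range normal_sum \<Longrightarrow> alg_D * a \<in> range normal_sum"
proof (rule range_normal_sum_mult)
  have "alg_D * (alg_E ^ i * alg_D ^ j) \<in> range normal_sum" for i j
  proof (induction i)
    case 0
    show ?case using monomial_in_range_normal_sum[of 0 "Suc j"] by simp
  next
    case (Suc i)
    let ?x = "alg_E ^ i * alg_D ^ j"
    have DE: "alg_D * alg_E = alg_scalar zyq_q * alg_E * alg_D + (alg_D + alg_E)"
      using alg_relation by (simp add: diff_eq_eq add.commute)
    have "alg_D * (alg_E ^ Suc i * alg_D ^ j) = (alg_D * alg_E) * ?x"
      by (simp add: mult.assoc)
    \<comment> \<open>Moving \<open>D\<close> past one \<open>E\<close> leaves \<open>D\<close> in
      front of the smaller monomial, where the induction hypothesis applies.\<close>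
    also have "\<dots> = alg_scalar zyq_q * (alg_E * (alg_D * ?x)) + (alg_D * ?x + alg_E * ?x)"
      unfolding DE by (simp add: distrib_right mult.assoc)
    finally show ?case
      using Suc by (simp only:) (intro range_normal_sum_add range_normal_sum_scalar
        range_normal_sum_E monomial_in_range_normal_sum)
  qed
  then show "alg_scalar d * (alg_D * (alg_E ^ i * alg_D ^ j)) \<in> range normal_sum" for d i j
    by (rule range_normal_sum_scalar)
qed (rule alg_scalar_commute_D)

lemma pasep_power_in_range_normal_sum:
  "(alg_scalar zyq_y * alg_D + alg_E) ^ N \<in> range normal_sum"
proof (induction N)
  case 0
  show ?case using monomial_in_range_normal_sum[of 0 0] by simp
next
  case (Suc N)
  then show ?case
    by (auto simp: distrib_right mult.assoc
        intro!: range_normal_sum_add range_normal_sum_scalar range_normal_sum_D range_normal_sum_E)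
qed

section \<open>Evaluation of the partition function\<close>

lemma pasep_Z_eq_alg_row:
  "pasep_Z N = alg_row ((alg_scalar zyq_y * alg_D + alg_E) ^ N) (\<lambda>k. alpha_tilde ^ k) 0"
proof -
  obtain c where c: "(alg_scalar zyq_y * alg_D + alg_E) ^ N = normal_sum c"
    using pasep_power_in_range_normal_sum by auto
  then have "pasep_coeffs N = c"
    by (simp add: pasep_coeffs_def normal_coeffs_normal_sum)
  then show ?thesis
    by (simp add: c alg_row_normal_sum pasep_Z_def partition_value_def)
qed

lemma alg_row_pasep_step:
  "alg_row (alg_scalar zyq_y * alg_D + alg_E) v k
    = 1 / (1 - ind_q) * motzkin_row ind_q ind_y beta_tilde v k"
proof -
  have "alg_row (alg_scalar zyq_y) v = (\<lambda>k. ind_y * v k + 0 * v k)"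
    by (simp add: fun_eq_iff alg_row_scalar ind_y_def)
  then have "alg_row (alg_scalar zyq_y * alg_D + alg_E) v k
      = ind_y * letter_row LD v k + letter_row LE v k"
    by (simp only: alg_row_add alg_row_mult alg_row_D alg_row_E letter_row_linear)
  then show ?thesis
    by (simp add: motzkin_row_def add_divide_distrib algebra_simps)
qed

lemma alg_row_pasep_power:
  "(alg_row (alg_scalar zyq_y * alg_D + alg_E) ^^ N) v k
    = 1 / (1 - ind_q) ^ N * (motzkin_row ind_q ind_y beta_tilde ^^ N) v k"
proof (induction N arbitrary: k)
  case 0
  show ?case by simp
next
  case (Suc N)
  let ?x = "alg_scalar zyq_y * alg_D + alg_E" and ?T = "motzkin_row ind_q ind_y beta_tilde"
  have IH: "(alg_row ?x ^^ N) v = (\<lambda>k. 1 / (1 - ind_q) ^ N * (?T ^^ N) v k)"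
    by (rule ext) (rule Suc)
  have "(alg_row ?x ^^ Suc N) v k = alg_row ?x ((alg_row ?x ^^ N) v) k"
    by simp
  also have "\<dots> = 1 / (1 - ind_q) ^ N * (1 / (1 - ind_q) * ?T ((?T ^^ N) v) k)"
    unfolding IH alg_row_scale alg_row_pasep_step ..
  finally show ?case by simp
qed

theorem theorem1p3:
  fixes N :: nat
  shows "pasep_Z N =
    1 / (1 - ind_q) ^ N *
      (\<Sum>n=0..N. pasep_R N n ind_y ind_q * pasep_B n alpha_tilde beta_tilde ind_y ind_q)"
  unfolding pasep_Z_eq_alg_row alg_row_power alg_row_pasep_power
    motzkin_row_power[OF q_int_ind_q_nonzero] hermite_row_at_0 atLeast0AtMost ..

end
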